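(* Let $(X_n,d_n)_{n\ge 0}$ be a sequence of compact metric spaces and let $\mathcal{F}=\{f_n\}_{n\ge 0}$ be a sequence of continuous onto maps $f_n:X_n\to X_{n+1}$. Suppose there is $\delta_0>0$ such that for every $n\ge 0$, every $w\in X_{n+1}$ and every $z\in f_n^{-1}(w)$ there exists a well-defined inverse branch $f_{n,z}^{-1}:B(w,\delta_0)\to V_z$, where $V_z\subset X_n$ is an open neighborhood of $z$. If $\mathcal{F}$ is strong-equicontinuous and has the shadowing property, then $\mathcal{F}$ has the limit shadowing property.
   Context: All the metrics $d_n$ are denoted simply by $d$. For $n\ge 1$ put $F_n:=f_{n-1}\circ\cdots\circ f_1\circ f_0:X_0\to X_n$, and let $F_0$ be the identity of $X_0$. For $n\ge m$ put $f_m^n:=f_n\circ f_{n-1}\circ\cdots\circ f_m$. $B(w,r)$ denotes the open ball of radius $r$ around $w$. An inverse branch $f_{n,z}^{-1}:B(w,\delta_0)\to V_z$ satisfies $f_n\circ f_{n,z}^{-1}=\mathrm{id}$ on $B(w,\delta_0)$ and $f_{n,z}^{-1}(w)=z$. Strong-equicontinuous: for every $\varepsilon>0$ there exists $\delta>0$ such that for all $n\ge m\ge 1$ and all $x,y\in X_m$, $d(x,y)<\delta$ implies $d(f_m^n(x),f_m^n(y))<\varepsilon$. Shadowing property: for every $\varepsilon>0$ there exists $\delta>0$ such that for every sequence $\{x_n\}_{n=0}^\infty$ with $x_n\in X_n$ and $d(f_n(x_n),x_{n+1})<\delta$ for all $n\ge 0$ (a $\delta$-pseudo-orbit), there exists $x\in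 X_0$ with $d(F_n(x),x_n)<\varepsilon$ for all $n\ge 0$. Limit shadowing property: for every sequence $\{x_n\}_{n\ge0}$ with $x_n\in X_n$ and $\lim_{i\to\infty}d(f_i(x_i),x_{i+1})=0$, there exists $y\in X_0$ with $\lim_{i\to\infty}d(F_i(y),x_i)=0$. *)

theory Defs
  imports "HOL-Analysis.Analysis"
begin

text \<open>
  The spaces \<open>X n\<close> are metric spaces with arbitrary carriers in a common ambient type, each with
  its own metric. Nothing is assumed about the values of \<open>f n\<close> outside the carrier of \<open>X n\<close>.
\<close>

text \<open>\<open>run f m k\<close> composes \<open>k\<close> consecutive maps starting at index \<open>m\<close>:
  it is \<open>f (m+k-1) \<circ> \<dots> \<circ> f m\<close>, a map from \<open>X m\<close> to \<open>X (m+k)\<close>.\<close>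

primrec run :: "(nat \<Rightarrow> 'a \<Rightarrow> 'a) \<Rightarrow> nat \<Rightarrow> nat \<Rightarrow> 'a \<Rightarrow> 'a" where
  "run f m 0 = id"
| "run f m (Suc k) = f (m + k) \<circ> run f m k"

text \<open>\<open>F_n = f (n-1) \<circ> \<dots> \<circ> f 0\<close>, with \<open>F_0 = id\<close>.\<close>

definition comp_upto :: "(nat \<Rightarrow> 'a \<Rightarrow> 'a) \<Rightarrow> nat \<Rightarrow> 'a \<Rightarrow> 'a" where
  "comp_upto f n = run f 0 n"

text \<open>\<open>f_m^n = f n \<circ> \<dots> \<circ> f m\<close>, with both end points included; used only for \<open>m \<le> n\<close>.
  It maps \<open>X m\<close> to \<open>X (Suc n)\<close>.\<close>

definition comp_between :: "(nat \<Rightarrow> 'a \<Rightarrow> 'a) \<Rightarrow> nat \<Rightarrow> nat \<Rightarrow> 'a \<Rightarrow> 'a" where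
  "comp_between f m n = run f m (Suc n - m)"

text \<open>\<open>g\<close> is an inverse branch of \<open>h : A \<rightarrow> B\<close> at \<open>z\<close>, defined on the open ball of radius \<open>r\<close>
  around \<open>w\<close> and with values in \<open>V\<close>. As in the source, no continuity of \<open>g\<close> is demanded.\<close>

definition inverse_branch ::
  "'b metric \<Rightarrow> ('a \<Rightarrow> 'b) \<Rightarrow> 'b \<Rightarrow> real \<Rightarrow> 'a \<Rightarrow> 'a set \<Rightarrow> ('b \<Rightarrow> 'a) \<Rightarrow> bool" where
  "inverse_branch B h w r z V g \<longleftrightarrow>
     g \<in> mball_of B w r \<rightarrow> V \<and> (\<forall>u \<in> mball_of B w r. h (g u) = u) \<and> g w = z"

definition strong_equicontinuous :: "(nat \<Rightarrow> 'a metric) \<Rightarrow> (nat \<Rightarrow> 'a \<Rightarrow> 'a) \<Rightarrow> bool" where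
  "strong_equicontinuous X f \<longleftrightarrow>
     (\<forall>\<epsilon>>0. \<exists>\<delta>>0. \<forall>m n. 1 \<le> m \<and> m \<le> n \<longrightarrow>
        (\<forall>x \<in> mspace (X m). \<forall>y \<in> mspace (X m). mdist (X m) x y < \<delta> \<longrightarrow>
           mdist (X (Suc n)) (comp_between f m n x) (comp_between f m n y) < \<epsilon>))"

definition pseudo_orbit ::
  "(nat \<Rightarrow> 'a metric) \<Rightarrow> (nat \<Rightarrow> 'a \<Rightarrow> 'a) \<Rightarrow> real \<Rightarrow> (nat \<Rightarrow> 'a) \<Rightarrow> bool" where
  "pseudo_orbit X f \<delta> x \<longleftrightarrow>
     (\<forall>n. x n \<in> mspace (X n)) \<and> (\<forall>n. mdist (X (Suc n)) (f n (x n)) (x (Suc n)) < \<delta>)"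

definition shadowing_property :: "(nat \<Rightarrow> 'a metric) \<Rightarrow> (nat \<Rightarrow> 'a \<Rightarrow> 'a) \<Rightarrow> bool" where
  "shadowing_property X f \<longleftrightarrow>
     (\<forall>\<epsilon>>0. \<exists>\<delta>>0. \<forall>x. pseudo_orbit X f \<delta> x \<longrightarrow>
        (\<exists>y \<in> mspace (X 0). \<forall>n. mdist (X n) (comp_upto f n y) (x n) < \<epsilon>))"

definition limit_shadowing_property :: "(nat \<Rightarrow> 'a metric) \<Rightarrow> (nat \<Rightarrow> 'a \<Rightarrow> 'a) \<Rightarrow> bool" where
  "limit_shadowing_property X f \<longleftrightarrow>
     (\<forall>x. (\<forall>n. x n \<in> mspace (X n)) \<and>
          (\<lambda>i. mdist (X (Suc i)) (f i (x i)) (x (Suc i))) \<longlonglongrightarrow> 0 \<longrightarrow>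
        (\<exists>y \<in> mspace (X 0). (\<lambda>i. mdist (X i) (comp_upto f i y) (x i)) \<longlonglongrightarrow> 0))"

end

theory Submission imports Defs begin

text \<open>
  The idea is to shadow the tails of an asymptotic pseudo-orbit with ever smaller error and to pass
  to the limit of the shadowing points in the compact space \<open>X 0\<close>.

  Let \<open>x\<close> be a sequence whose one-step errors tend to \<open>0\<close>. For each \<open>\<epsilon> > 0\<close> the errors are
  eventually below the \<open>\<delta>\<close> that the shadowing property assigns to \<open>\<epsilon>\<close>, say from time \<open>N\<close> on. As
  the maps are onto, \<open>x N\<close> is the value at time \<open>N\<close> of a true orbit; replacing the first \<open>N\<close> terms
  of \<open>x\<close> by that orbit gives an honest \<open>\<delta>\<close>-pseudo-orbit, which some point of \<open>X 0\<close> shadows. So \<open>x\<close>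
  is eventually \<open>\<epsilon>\<close>-shadowed (\<open>tail_shadowing\<close>).

  Taking \<open>\<epsilon> = 1 / (k + 1)\<close> yields points \<open>a k\<close>, and a subsequence of them converges to some \<open>y\<close>.
  Equicontinuity from time \<open>1\<close>, together with the continuity of \<open>f 0\<close>, makes the
  whole orbit of \<open>a k\<close> uniformly close to that of \<open>y\<close> once \<open>a k\<close> is close to \<open>y\<close>
  (\<open>orbits_converge_uniformly\<close>). Hence the orbit of \<open>y\<close> is asymptotic to \<open>x\<close>: the uniformity in
  time allows \<open>k\<close> to be chosen before time is sent to infinity.
\<close>

lemma run_image:
  assumes "\<And>n. f n ` mspace (X n) = mspace (X (Suc n))"
  shows "run f m k ` mspace (X m) = mspace (X (m + k))"
proof (induction k)
  case (Suc k)
  then show ?case using assms[of "m + k"] by (simp flip: image_image)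
qed simp

lemma run_Suc_right: "run f m (Suc k) x = run f (Suc m) k (f m x)"
  by (induction k) auto

lemma comp_upto_in_mspace:
  assumes "\<And>n. f n ` mspace (X n) = mspace (X (Suc n))" and "x \<in> mspace (X 0)"
  shows "comp_upto f n x \<in> mspace (X n)"
  using run_image[where f=f and X=X, OF assms(1), of 0 n] assms(2)
  unfolding comp_upto_def by auto

text \<open>
  Strong equicontinuity speaks of the maps starting at times \<open>m \<ge> 1\<close> only; the first map \<open>f 0\<close> has
  to be handled by its continuity, and convergence of the starting points is what continuity
  transports.
\<close>

lemma orbits_converge_uniformly:
  fixes X :: "nat \<Rightarrow> 'a metric"
  assumes continuous: "continuous_map (mtopology_of (X 0)) (mtopology_of (X 1)) (f 0)"
    and onto: "\<And>n. f n ` mspace (X n) = mspace (X (Suc n))"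
    and equicontinuous: "strong_equicontinuous X f"
    and lim: "limitin (mtopology_of (X 0)) a y sequentially"
    and "\<epsilon> > 0"
  shows "\<forall>\<^sub>F k in sequentially. \<forall>n. mdist (X n) (comp_upto f n (a k)) (comp_upto f n y) < \<epsilon>"
proof -
  obtain \<delta> where "\<delta> > 0" and \<delta>: "\<And>n u v. \<lbrakk>1 \<le> n; u \<in> mspace (X 1); v \<in> mspace (X 1);
      mdist (X 1) u v < \<delta>\<rbrakk> \<Longrightarrow> mdist (X (Suc n)) (run f 1 n u) (run f 1 n v) < \<epsilon>"
    using equicontinuous[unfolded strong_equicontinuous_def comp_between_def, rule_format, OF \<open>\<epsilon> > 0\<close>]
    by fastforce
  interpret M0: Metric_space "mspace (X 0)" "mdist (X 0)" by simp
  interpret M1: Metric_space "mspace (X 1)" "mdist (X 1)" by simp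
  have lim1: "limitin (mtopology_of (X 1)) (f 0 \<circ> a) (f 0 y) sequentially"
    using continuous_map_limit[OF continuous lim] by (simp add: comp_def)
  have y: "y \<in> mspace (X 0)"
    and near0: "\<forall>\<^sub>F k in sequentially. a k \<in> mspace (X 0) \<and> mdist (X 0) (a k) y < \<epsilon>"
    using lim \<open>\<epsilon> > 0\<close> unfolding mtopology_of_def M0.limitin_metric by auto
  have near1: "\<forall>\<^sub>F k in sequentially. mdist (X 1) (f 0 (a k)) (f 0 y) < min \<delta> \<epsilon>"
    using lim1 \<open>\<epsilon> > 0\<close> \<open>\<delta> > 0\<close> unfolding mtopology_of_def M1.limitin_metric
    by (auto elim!: allE[where x = "min \<delta> \<epsilon>"] eventually_mono)
  from near0 near1 show ?thesis
  proof eventually_elim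
    case (elim k)
    show ?case
    proof
      fix n
      have in1: "f 0 (a k) \<in> mspace (X 1)" "f 0 y \<in> mspace (X 1)"
        using elim y onto[of 0] by auto
      consider "n = 0" | "n = 1" | m where "n = Suc m" "1 \<le> m"
        by (cases n; cases "n - 1") auto
      then show "mdist (X n) (comp_upto f n (a k)) (comp_upto f n y) < \<epsilon>"
      proof cases
        case 3
        have "mdist (X (Suc m)) (run f 1 m (f 0 (a k))) (run f 1 m (f 0 y)) < \<epsilon>"
          using elim by (intro \<delta> in1 \<open>1 \<le> m\<close>) auto
        then show ?thesis
          unfolding comp_upto_def \<open>n = Suc m\<close> run_Suc_right by simp
      qed (use elim in \<open>auto simp: comp_upto_def\<close>)
    qed
  qed
qed

text \<open>
  A tail of \<open>x\<close> with small errors extends backwards to a complete pseudo-orbit that makes no error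
  at all up to its starting time, because surjectivity lets a true orbit arrive at the tail.
\<close>

lemma tail_shadowing:
  fixes X :: "nat \<Rightarrow> 'a metric"
  assumes onto: "\<And>n. f n ` mspace (X n) = mspace (X (Suc n))"
    and shadowing: "shadowing_property X f"
    and x: "\<And>n. x n \<in> mspace (X n)"
    and err: "(\<lambda>i. mdist (X (Suc i)) (f i (x i)) (x (Suc i))) \<longlonglongrightarrow> 0"
    and "\<epsilon> > 0"
  shows "\<exists>a \<in> mspace (X 0). \<forall>\<^sub>F n in sequentially. mdist (X n) (comp_upto f n a) (x n) < \<epsilon>"
proof -
  obtain \<delta> where "\<delta> > 0" and \<delta>: "\<And>z. pseudo_orbit X f \<delta> z \<Longrightarrow>
      \<exists>a \<in> mspace (X 0). \<forall>n. mdist (X n) (comp_upto f n a) (z n) < \<epsilon>"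
    using shadowing \<open>\<epsilon> > 0\<close> unfolding shadowing_property_def by meson
  obtain N where N: "\<And>n. n \<ge> N \<Longrightarrow> mdist (X (Suc n)) (f n (x n)) (x (Suc n)) < \<delta>"
    using order_tendstoD(2)[OF err \<open>\<delta> > 0\<close>] unfolding eventually_sequentially by auto
  obtain b where b: "b \<in> mspace (X 0)" "comp_upto f N b = x N"
    using run_image[where f=f and X=X, OF onto, of 0 N] x[of N]
    unfolding comp_upto_def by (metis add_0 imageE)
  define z where "z n = (if n < N then comp_upto f n b else x n)" for n
  have z_in: "z n \<in> mspace (X n)" for n
    using x comp_upto_in_mspace[where f=f and X=X, OF onto b(1)] by (simp add: z_def)
  have "mdist (X (Suc n)) (f n (z n)) (z (Suc n)) < \<delta>" for n
  proof (cases "n < N")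
    case True
    then have "z (Suc n) = comp_upto f (Suc n) b"
      using b(2) by (cases "Suc n = N") (auto simp: z_def)
    then have "f n (z n) = z (Suc n)"
      using True by (simp add: z_def comp_upto_def)
    then show ?thesis using mdist_zero z_in[of "Suc n"] \<open>\<delta> > 0\<close> by metis
  next
    case False
    then show ?thesis using N by (simp add: z_def)
  qed
  then have "pseudo_orbit X f \<delta> z"
    using z_in by (simp add: pseudo_orbit_def)
  then obtain a where "a \<in> mspace (X 0)" "\<And>n. mdist (X n) (comp_upto f n a) (z n) < \<epsilon>"
    using \<delta> by blast
  moreover have "\<forall>\<^sub>F n in sequentially. z n = x n"
    using eventually_ge_at_top[of N] by eventually_elim (simp add: z_def)
  ultimately show ?thesis
    by (intro bexI[of _ a]) (auto elim!: eventually_mono, metis)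
qed

theorem theorem3p2:
  fixes X :: "nat \<Rightarrow> 'a metric"
    and f :: "nat \<Rightarrow> 'a \<Rightarrow> 'a"
    and \<delta>0 :: real
  assumes compact: "\<And>n. compact_space (mtopology_of (X n))"
    and continuous: "\<And>n. continuous_map (mtopology_of (X n)) (mtopology_of (X (Suc n))) (f n)"
    and onto: "\<And>n. f n ` mspace (X n) = mspace (X (Suc n))"
    and pos: "\<delta>0 > 0"
    and branches: "\<And>n w z. w \<in> mspace (X (Suc n)) \<Longrightarrow> z \<in> mspace (X n) \<Longrightarrow> f n z = w \<Longrightarrow>
        \<exists>V g. openin (mtopology_of (X n)) V \<and> z \<in> V \<and>
              inverse_branch (X (Suc n)) (f n) w \<delta>0 z V g"
    and equicontinuous: "strong_equicontinuous X f"
    and shadowing: "shadowing_property X f"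
  shows "limit_shadowing_property X f"
proof -
  have "\<exists>y \<in> mspace (X 0). (\<lambda>i. mdist (X i) (comp_upto f i y) (x i)) \<longlonglongrightarrow> 0"
    if x: "\<And>n. x n \<in> mspace (X n)"
      and err: "(\<lambda>i. mdist (X (Suc i)) (f i (x i)) (x (Suc i))) \<longlonglongrightarrow> 0" for x
  proof -
    interpret M0: Metric_space "mspace (X 0)" "mdist (X 0)" by simp
    have "\<forall>k. \<exists>a \<in> mspace (X 0). \<forall>\<^sub>F n in sequentially.
        mdist (X n) (comp_upto f n a) (x n) < inverse (real (Suc k))"
      using tail_shadowing[where f=f and X=X, OF onto shadowing x err] by simp
    then obtain a where a_in: "\<And>k. a k \<in> mspace (X 0)"
      and a: "\<And>k. \<forall>\<^sub>F n in sequentially.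
        mdist (X n) (comp_upto f n (a k)) (x n) < inverse (real (Suc k))"
      unfolding bchoice_iff choice_iff Bex_def by blast
    obtain y r where y: "y \<in> mspace (X 0)" and "strict_mono (r :: nat \<Rightarrow> nat)"
      and lim: "limitin (mtopology_of (X 0)) (a \<circ> r) y sequentially"
      using compact[of 0, unfolded mtopology_of_def M0.compact_space_sequentially, rule_format, of a] a_in
      unfolding mtopology_of_def by blast
    have "(\<lambda>i. mdist (X i) (comp_upto f i y) (x i)) \<longlonglongrightarrow> 0"
    proof (rule order_tendstoI)
      fix \<epsilon> :: real assume "\<epsilon> > 0"
      have "\<forall>\<^sub>F k in sequentially. inverse (real (Suc k)) < \<epsilon> / 2"
        by (rule order_tendstoD(2)[OF LIMSEQ_inverse_real_of_nat]) (use \<open>\<epsilon> > 0\<close> in simp)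
      then have "\<forall>\<^sub>F k in sequentially. inverse (real (Suc (r k))) < \<epsilon> / 2"
        using eventually_subseq[OF \<open>strict_mono r\<close>] by fast
      moreover have "\<forall>\<^sub>F k in sequentially.
          \<forall>n. mdist (X n) (comp_upto f n (a (r k))) (comp_upto f n y) < \<epsilon> / 2"
        using orbits_converge_uniformly[where f=f and X=X, OF _ onto equicontinuous lim, of "\<epsilon> / 2"]
          continuous[of 0] \<open>\<epsilon> > 0\<close> by simp
      ultimately obtain k where k: "inverse (real (Suc (r k))) < \<epsilon> / 2"
        and close: "\<And>n. mdist (X n) (comp_upto f n (a (r k))) (comp_upto f n y) < \<epsilon> / 2"
        using eventually_happens[OF eventually_conj] by fastforce
      from a[of "r k"]
      show "\<forall>\<^sub>F n in sequentially. mdist (X n) (comp_upto f n y) (x n) < \<epsilon>"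
      proof eventually_elim
        case (elim n)
        interpret Mn: Metric_space "mspace (X n)" "mdist (X n)" by simp
        have "mdist (X n) (comp_upto f n y) (x n)
            \<le> mdist (X n) (comp_upto f n (a (r k))) (comp_upto f n y)
              + mdist (X n) (comp_upto f n (a (r k))) (x n)"
          by (intro Mn.triangle'') (use onto x y a_in in \<open>auto intro!: comp_upto_in_mspace\<close>)
        then show ?case using elim close[of n] k by linarith
      qed
    qed (auto intro: always_eventually order_less_le_trans[OF _ mdist_nonneg])
    then show ?thesis using y by blast
  qed
  then show ?thesis unfolding limit_shadowing_property_def by blast
qed

end
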